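(* Let $T\in GL(2,\mathbb{R})$. Suppose that either $T$ has real eigenvalues, or $T$ has complex (non-real) eigenvalues of the form $t(\cos\theta\pm i\sin\theta)$ with $t>0$, where either $0<\cos\theta<1$ or $\|T\|>5\sqrt{\det T}$. Then there exists $a\in\mathbb{R}^2$ such that $0<\|T^{-1}(a)\|<1$, the map $\overline{T}_a:\mathbb{S}^1\to\mathbb{S}^1$ has a fixed point or a periodic point of order $2$, and $\overline{T}_a$ is not distal.
   Context: $\|\cdot\|$ is the Euclidean norm on $\mathbb{R}^2$, and for matrices the corresponding operator norm; $\mathbb{S}^1$ is the unit circle in $\mathbb{R}^2$. For $T\in GL(2,\mathbb{R})$ and $a\in\mathbb{R}^2\setminus\{0\}$ with $\|T^{-1}(a)\|<1$, the map $\overline{T}_a:\mathbb{S}^1\to\mathbb{S}^1$ is defined by $\overline{T}_a(x)=(a+T(x))/\|a+T(x)\|$; it is a well-defined homeomorphism. A homeomorphism $S$ of a Hausdorff space $X$ is distal if for every pair of distinct points $x,y\in X$, the closure of $\{(S^m(x),S^m(y))\mid m\in\mathbb{Z}\}$ in $X\times X$ does not intersect the diagonal $\{(d,d)\mid d\in X\}$. *)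

theory Defs
  imports "HOL-Analysis.Analysis"
begin

definition eigenvalues :: "'a::field^'n^'n \<Rightarrow> 'a set" where
  "eigenvalues A = {l. \<exists>v. v \<noteq> 0 \<and> A *v v = l *s v}"

text \<open>The eigenvalues of a real matrix are taken in the complex numbers.\<close>

definition complex_eigenvalues :: "real^'n^'n \<Rightarrow> complex set" where
  "complex_eigenvalues A = eigenvalues (map_matrix complex_of_real A)"

definition circle_map :: "real^2^2 \<Rightarrow> real^2 \<Rightarrow> real^2 \<Rightarrow> real^2" where
  "circle_map T a x = (a + T *v x) /\<^sub>R norm (a + T *v x)"

text \<open>Integer iterates of a self-bijection \<^term>\<open>f\<close> of the set \<^term>\<open>S\<close>; the inverse is taken
  relative to \<^term>\<open>S\<close>, as \<^term>\<open>f\<close> need not be injective on the whole type.\<close>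

definition int_iterate :: "'a set \<Rightarrow> ('a \<Rightarrow> 'a) \<Rightarrow> int \<Rightarrow> 'a \<Rightarrow> 'a" where
  "int_iterate S f m = (if 0 \<le> m then f ^^ nat m else inv_into S f ^^ nat (- m))"

text \<open>Distality is meant for a homeomorphism \<^term>\<open>f\<close> of a Hausdorff space \<^term>\<open>X\<close>. These standing
  assumptions are not part of the definition, so that the negation of \<^term>\<open>distal\<close> cannot hold
  merely because one of them fails.\<close>

definition distal :: "'a topology \<Rightarrow> ('a \<Rightarrow> 'a) \<Rightarrow> bool" where
  "distal X f \<longleftrightarrow>
    (\<forall>x \<in> topspace X. \<forall>y \<in> topspace X. x \<noteq> y \<longrightarrow>
      prod_topology X X closure_of
        (range (\<lambda>m. (int_iterate (topspace X) f m x, int_iterate (topspace X) f m y)))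
      \<inter> {(d, d) | d. d \<in> topspace X} = {})"

definition has_fixed_point_on :: "'a set \<Rightarrow> ('a \<Rightarrow> 'a) \<Rightarrow> bool" where
  "has_fixed_point_on S f \<longleftrightarrow> (\<exists>x\<in>S. f x = x)"

definition has_periodic_point_of_order_2_on :: "'a set \<Rightarrow> ('a \<Rightarrow> 'a) \<Rightarrow> bool" where
  "has_periodic_point_of_order_2_on S f \<longleftrightarrow> (\<exists>x\<in>S. f (f x) = x \<and> f x \<noteq> x)"

end

theory Submission
  imports Defs
begin

text \<open>A repelling periodic point \<open>p\<close> excludes distality: the backward orbit of any nearby point
  converges to \<open>p\<close> along multiples of the period. So it suffices to choose \<open>a\<close> such that the circle
  map has a periodic point of order at most 2 whose multiplier exceeds 1 in absolute value.

  If some unit vector \<open>p\<close> satisfies \<open>T\<inverse> p \<bullet> p > 0\<close>, take \<open>a = r p - T p\<close> with \<open>r > 0\<close> small: then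
  \<open>p\<close> is fixed with multiplier \<open>det T * (T\<inverse> p \<bullet> p) / r\<close>. This covers a positive eigenvalue, and also
  the non-real case. There the determinant is positive and it is enough to find \<open>q\<close> with
  \<open>q \<bullet> T q > 0\<close>; if there is none, then the trace is nonpositive and the squared Frobenius norm is
  at most \<open>6 det T\<close>, contradicting both alternatives.

  If \<open>T v = - l v\<close> with \<open>l > 0\<close> and \<open>\<mu>\<close> is the other eigenvalue, take \<open>a = s v\<close> with \<open>0 < s < l\<close>:
  then \<open>v\<close> and \<open>- v\<close> are exchanged, with multiplier \<open>\<mu>\<^sup>2 / (l\<^sup>2 - s\<^sup>2)\<close>, which is large for \<open>s\<close>
  close to \<open>l\<close>.

  Distances to \<open>p\<close> on the circle are estimated from below by the area form \<open>cross2 p\<close>, whose ratio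
  to the distance tends to 1 at \<open>p\<close>.\<close>

section \<open>Iterates of bijections and repelling periodic points\<close>

lemma funpow_bij_betw: "bij_betw (f ^^ n) S S" if "bij_betw f S S"
  using that by (induction n) (auto intro: bij_betw_trans simp: bij_betw_id)

lemma funpow_inv_into_cancel:
  assumes "bij_betw f S S" and "x \<in> S"
  shows "(f ^^ n) ((inv_into S f ^^ n) x) = x"
proof (induction n)
  case (Suc n)
  have "(inv_into S f ^^ n) x \<in> S"
    using funpow_bij_betw[OF bij_betw_inv_into[OF assms(1)]] assms(2)
    by (meson bij_betwE)
  hence "f (inv_into S f ((inv_into S f ^^ n) x)) = (inv_into S f ^^ n) x"
    using assms(1) by (meson bij_betw_inv_into_right)
  hence "(f ^^ n) (f (inv_into S f ((inv_into S f ^^ n) x))) = x"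
    using Suc by simp
  thus ?case by (simp add: funpow_swap1)
qed simp

lemma continuous_on_funpow:
  assumes "continuous_on S f" and "f ` S \<subseteq> S"
  shows "continuous_on S (f ^^ n) \<and> (f ^^ n) ` S \<subseteq> S"
proof (induction n)
  case (Suc n)
  have "continuous_on S (f \<circ> f ^^ n)"
    using Suc assms by (intro continuous_on_compose) (auto intro: continuous_on_subset)
  thus ?case using Suc assms by (auto simp: image_subset_iff)
qed auto

text \<open>Compactness makes the inverse of \<open>f\<close> continuous, so close to
  \<open>p\<close> its \<open>N\<close>-th iterate \<open>h\<close> contracts distances to
  \<open>p\<close> by the factor \<open>1 / k\<close>. As \<open>h\<close> fixes \<open>p\<close>,
  the pairs \<open>((h ^^ n) y, p)\<close> converge to the diagonal for every \<open>y\<close> near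
  \<open>p\<close>; \<open>p islimpt S\<close> supplies such a \<open>y\<close> other than
  \<open>p\<close>.\<close>

lemma not_distal_if_repelling_periodic_point:
  fixes f :: "'a::metric_space \<Rightarrow> 'a"
  assumes "compact S" "continuous_on S f" "bij_betw f S S"
    and p: "p \<in> S" "(f ^^ N) p = p" "p islimpt S"
    and "k > 1"
    and ev: "\<forall>\<^sub>F z in at p within S. k * dist z p \<le> dist ((f ^^ N) z) p"
  shows "\<not> distal (top_of_set S) f"
proof -
  define g where "g = inv_into S f"
  define h where "h = g ^^ N"
  have gbij: "bij_betw g S S"
    unfolding g_def by (rule bij_betw_inv_into) fact
  have "continuous_on (f ` S) g"
    using assms(1-3) unfolding g_def
    by (intro continuous_on_inv) (auto simp: bij_betw_def)
  hence gcont: "continuous_on S g"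
    using assms(3) by (simp add: bij_betw_def)
  have hbij: "bij_betw h S S"
    unfolding h_def by (rule funpow_bij_betw) fact
  have hS: "h z \<in> S" if "z \<in> S" for z
    using hbij that by (meson bij_betwE)
  have hcont: "continuous_on S h"
    using continuous_on_funpow[OF gcont] gbij by (simp add: h_def bij_betw_def)
  have fh: "(f ^^ N) (h z) = z" if "z \<in> S" for z
    using funpow_inv_into_cancel[OF assms(3) that] by (simp add: h_def g_def)
  have hp: "h p = p"
  proof -
    have "inj_on (f ^^ N) S"
      using funpow_bij_betw[OF assms(3)] by (auto simp: bij_betw_def)
    thus ?thesis using fh[OF p(1)] p hS by (metis inj_onD)
  qed
  obtain e where e: "e > 0" "\<And>z. z \<in> S \<Longrightarrow> dist z p < e \<Longrightarrow> k * dist z p \<le> dist ((f ^^ N) z) p"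
  proof -
    obtain e where "e > 0" and
      e: "\<And>z. z \<in> S \<Longrightarrow> z \<noteq> p \<Longrightarrow> dist z p < e \<Longrightarrow> k * dist z p \<le> dist ((f ^^ N) z) p"
      using ev unfolding eventually_at by blast
    moreover have "k * dist p p \<le> dist ((f ^^ N) p) p" by simp
    ultimately show ?thesis using that by metis
  qed
  obtain d where d: "d > 0" "\<And>z. z \<in> S \<Longrightarrow> dist z p < d \<Longrightarrow> dist (h z) p < e"
    using hcont p(1) e(1) hp unfolding continuous_on_iff by metis
  obtain y where y: "y \<in> S" "y \<noteq> p" "dist y p < d"
    using p(3) d(1) unfolding islimpt_approachable by blast
  have contr: "dist (h z) p \<le> dist z p / k" if "z \<in> S" "dist z p < d" for z
    using e(2)[OF hS[OF that(1)] d(2)[OF that]] fh[OF that(1)] \<open>k > 1\<close>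
    by (simp add: field_simps)
  have iter: "(h ^^ n) y \<in> S \<and> dist ((h ^^ n) y) p \<le> dist y p / k ^ n" for n
  proof (induction n)
    case (Suc n)
    have "dist y p / k ^ n \<le> dist y p"
      using \<open>k > 1\<close> divide_left_mono[of 1 "k ^ n" "dist y p"] by simp
    hence "dist ((h ^^ n) y) p < d" using Suc y by linarith
    hence "dist (h ((h ^^ n) y)) p \<le> dist ((h ^^ n) y) p / k"
      using contr Suc by blast
    also have "\<dots> \<le> (dist y p / k ^ n) / k"
      using Suc \<open>k > 1\<close> by (intro divide_right_mono) auto
    finally show ?case using Suc hS by (simp add: field_simps)
  qed (use y in auto)
  have "(\<lambda>n. dist y p * inverse k ^ n) \<longlonglongrightarrow> dist y p * 0"
    using \<open>k > 1\<close> by (intro tendsto_intros LIMSEQ_power_zero) (auto simp: field_simps)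
  hence lim0: "(\<lambda>n. dist y p * inverse k ^ n) \<longlonglongrightarrow> 0" by simp
  have "dist ((h ^^ n) y) p \<le> dist y p * inverse k ^ n" for n
    using iter[of n] by (simp add: divide_inverse power_inverse)
  hence "(\<lambda>n. dist ((h ^^ n) y) p) \<longlonglongrightarrow> 0"
    by (intro tendsto_sandwich[OF _ _ tendsto_const lim0]) auto
  hence lim: "(\<lambda>n. (h ^^ n) y) \<longlonglongrightarrow> p"
    by (rule tendsto_dist_iff[THEN iffD2])
  have hnp: "(h ^^ n) p = p" for n
    by (induction n) (auto simp: hp)
  \<comment> \<open>For \<open>N * n = 0\<close> the exponent falls under the forward branch of
    \<open>int_iterate\<close>, hence the separate case.\<close>
  have int_it: "int_iterate S f (- int (N * n)) = h ^^ n" for n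
  proof (cases "N * n = 0")
    case True
    thus ?thesis unfolding int_iterate_def h_def by (auto simp: funpow_mult funpow_0)
  next
    case False
    hence "\<not> 0 \<le> - int (N * n)" by linarith
    thus ?thesis
      unfolding int_iterate_def h_def g_def[symmetric]
      by (simp only: if_False funpow_mult minus_minus nat_int)
  qed
  let ?R = "range (\<lambda>m. (int_iterate S f m y, int_iterate S f m p))"
  have mem: "((h ^^ n) y, p) \<in> ?R" for n
    by (rule image_eqI[where x = "- int (N * n)"]) (auto simp only: int_it hnp)
  have "(\<lambda>n. ((h ^^ n) y, p)) \<longlonglongrightarrow> (p, p)"
    using lim by (intro tendsto_intros)
  moreover have "((h ^^ n) y, p) \<in> (S \<times> S) \<inter> ?R" for n
    using mem iter p by auto
  ultimately have "(p, p) \<in> closure ((S \<times> S) \<inter> ?R)"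
    unfolding closure_sequential by (intro exI[of _ "\<lambda>n. ((h ^^ n) y, p)"] conjI allI)
  hence "(p, p) \<in> prod_topology (top_of_set S) (top_of_set S) closure_of ?R"
    using p by (simp add: closure_of_subtopology)
  thus ?thesis
    using y p unfolding distal_def by fastforce
qed

section \<open>The area form on the plane and its restriction to the unit circle\<close>

definition cross2 :: "real^2 \<Rightarrow> real^2 \<Rightarrow> real" where
  "cross2 x y = x$1 * y$2 - x$2 * y$1"

definition perp :: "real^2 \<Rightarrow> real^2" where
  "perp x = vector [- x$2, x$1]"

lemmas vec2_simps = inner_vec_def norm_eq_sqrt_inner sum_2 matrix_vector_mult_def det_2

lemma cross2_diff: "cross2 x (y - z) = cross2 x y - cross2 x z"
  by (simp add: cross2_def algebra_simps)

lemma cross2_add: "cross2 x (y + z) = cross2 x y + cross2 x z"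
  by (simp add: cross2_def algebra_simps)

lemma cross2_scaleR [simp]: "cross2 x (c *\<^sub>R y) = c * cross2 x y" "cross2 (c *\<^sub>R x) y = c * cross2 x y"
  by (simp_all add: cross2_def algebra_simps)

lemma cross2_self [simp]: "cross2 x x = 0"
  by (simp add: cross2_def)

lemma cross2_perp: "cross2 x (perp y) = x \<bullet> y"
  by (simp add: cross2_def perp_def vec2_simps)

lemma norm_perp [simp]: "norm (perp x) = norm x"
  by (simp add: perp_def vec2_simps)

lemma cross2_sq: "(cross2 x y)\<^sup>2 + (x \<bullet> y)\<^sup>2 = (norm x)\<^sup>2 * (norm y)\<^sup>2"
  by (simp add: cross2_def power2_norm_eq_inner vec2_simps) (simp add: algebra_simps power2_eq_square)

lemma abs_cross2_le: "\<bar>cross2 x y\<bar> \<le> norm x * norm y"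
proof (rule power2_le_imp_le)
  have "(cross2 x y)\<^sup>2 \<le> (norm x)\<^sup>2 * (norm y)\<^sup>2"
    unfolding cross2_sq[symmetric] by simp
  thus "\<bar>cross2 x y\<bar>\<^sup>2 \<le> (norm x * norm y)\<^sup>2"
    by (simp add: power_mult_distrib)
qed simp

lemma cross2_matrix: "cross2 (T *v x) (T *v y) = det T * cross2 x y"
  by (simp add: cross2_def vec2_simps algebra_simps)

text \<open>If \<alpha> is the angle between \<open>p\<close> and \<open>z\<close>, this is sin
  \<alpha> = 2 sin(\<alpha>/2) cos(\<alpha>/2): the chord has length 2 sin(\<alpha>/2), and the
  square root is cos(\<alpha>/2), which tends to 1 as \<open>z\<close> approaches
  \<open>p\<close>.\<close>

lemma abs_cross2_unit:
  assumes "norm p = 1" "norm z = 1"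
  shows "\<bar>cross2 p z\<bar> = norm (z - p) * sqrt ((1 + p \<bullet> z) / 2)"
proof -
  have "(norm (z - p))\<^sup>2 = 2 - 2 * (p \<bullet> z)"
    using assms by (simp add: power2_norm_eq_inner inner_diff inner_commute norm_eq_1)
  moreover have "(cross2 p z)\<^sup>2 = 1 - (p \<bullet> z)\<^sup>2"
    using cross2_sq[of p z] assms by simp
  ultimately have "(cross2 p z)\<^sup>2 = (norm (z - p))\<^sup>2 * ((1 + p \<bullet> z) / 2)"
    by (simp only:) (simp add: field_simps power2_eq_square)
  hence "sqrt ((cross2 p z)\<^sup>2) = sqrt ((norm (z - p))\<^sup>2 * ((1 + p \<bullet> z) / 2))"
    by (rule arg_cong)
  thus ?thesis by (simp only: real_sqrt_mult real_sqrt_abs abs_norm_cancel)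
qed

lemma orthonormal_expansion:
  assumes "norm p = 1"
  shows "z = (p \<bullet> z) *\<^sub>R p + cross2 p z *\<^sub>R perp p"
proof -
  have 1: "p$1 * p$1 + p$2 * p$2 = 1"
    using assms by (simp add: norm_eq_1 vec2_simps)
  have "z$1 = (p$1 * p$1 + p$2 * p$2) * z$1" "z$2 = (p$1 * p$1 + p$2 * p$2) * z$2"
    using 1 by simp_all
  thus ?thesis
    by (simp add: vec_eq_iff forall_2 perp_def cross2_def vec2_simps algebra_simps)
qed

lemma islimpt_circle: "p islimpt sphere 0 1" if "norm p = 1" for p :: "real^2"
proof (rule connected_imp_perfect)
  show "connected (sphere (0::real^2) 1)" by (rule connected_sphere) simp
  show "p \<in> sphere 0 1" using that by simp
  have "p \<noteq> - p" using that by (metis eq_neg_iff_add_eq_0 norm_zero scaleR_2 scaleR_eq_0_iff zero_neq_numeral zero_neq_one)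
  moreover have "p \<in> sphere 0 1" "- p \<in> sphere 0 1" using that by auto
  ultimately show "sphere 0 1 \<noteq> {x}" for x :: "real^2" by (metis singletonD)
qed

section \<open>The circle map as a homeomorphism\<close>

lemma matrix_inv_mul_cancel [simp]:
  fixes T :: "real^'n^'n"
  assumes "invertible T"
  shows "matrix_inv T *v (T *v x) = x" "T *v (matrix_inv T *v x) = x"
proof -
  have "T ** matrix_inv T = mat 1 \<and> matrix_inv T ** T = mat 1"
    using assms unfolding invertible_def matrix_inv_def by (rule someI_ex)
  thus "matrix_inv T *v (T *v x) = x" "T *v (matrix_inv T *v x) = x"
    by (simp_all add: matrix_vector_mul_assoc)
qed

text \<open>A ray issuing from the point \<open>- b\<close> of the open unit ball leaves the ball
  only once: both parameters solve the same quadratic equation, and if they differed, Vieta would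
  give \<open>m * n * (w \<bullet> w) = b \<bullet> b - 1 < 0\<close>.\<close>

lemma ray_unique:
  fixes w b :: "'v::real_inner"
  assumes "norm b < 1" "m > 0" "n > 0" "norm (m *\<^sub>R w - b) = 1" "norm (n *\<^sub>R w - b) = 1"
  shows "m = n"
proof (rule ccontr)
  assume "m \<noteq> n"
  have eq: "m\<^sup>2 * (w \<bullet> w) - 2 * m * (w \<bullet> b) = 1 - b \<bullet> b" "n\<^sup>2 * (w \<bullet> w) - 2 * n * (w \<bullet> b) = 1 - b \<bullet> b"
    using assms(4,5)
    by (simp_all add: norm_eq_1 inner_diff inner_commute power2_eq_square algebra_simps)
  have pos: "1 - b \<bullet> b > 0"
    using assms(1) by (simp add: norm_eq_sqrt_inner)
  have "(m - n) * ((m + n) * (w \<bullet> w) - 2 * (w \<bullet> b)) = 0"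
    using eq by (simp add: algebra_simps power2_eq_square)
  hence "2 * (w \<bullet> b) = (m + n) * (w \<bullet> w)"
    using \<open>m \<noteq> n\<close> by simp
  hence "- (m * n * (w \<bullet> w)) = 1 - b \<bullet> b"
    using eq(1) by (simp add: algebra_simps power2_eq_square)
  moreover have "m * n * (w \<bullet> w) \<ge> 0" using assms by simp
  ultimately show False using pos by linarith
qed

lemma ray_exists:
  fixes w b :: "'v::real_inner"
  assumes "norm b < 1" "w \<noteq> 0"
  obtains m where "m > 0" "norm (m *\<^sub>R w - b) = 1"
proof -
  \<comment> \<open>The intermediate value theorem is applied between the parameter
    \<open>0\<close>, where the norm is \<open>norm b < 1\<close>, and \<open>2 / norm w\<close>,
    where it is at least \<open>2 - norm b > 1\<close>.\<close>
  have "norm ((2 / norm w) *\<^sub>R w - b) \<ge> norm ((2 / norm w) *\<^sub>R w) - norm b"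
    by (rule norm_triangle_ineq2)
  hence "norm ((2 / norm w) *\<^sub>R w - b) \<ge> 1"
    using assms by simp
  hence "\<exists>m\<ge>0. m \<le> 2 / norm w \<and> norm (m *\<^sub>R w - b) = 1"
    using assms by (intro IVT') (auto intro!: continuous_intros)
  then obtain m where "m \<ge> 0" "norm (m *\<^sub>R w - b) = 1" by blast
  moreover have "m \<noteq> 0" using calculation assms by auto
  ultimately show ?thesis using that[of m] by simp
qed

locale circle_homeo =
  fixes T :: "real^2^2" and a :: "real^2"
  assumes inv: "invertible T" and small: "norm (matrix_inv T *v a) < 1"
begin

lemma nonzero: "a + T *v x \<noteq> 0" if "norm x = 1"
proof
  assume "a + T *v x = 0"
  hence "matrix_inv T *v (a + T *v x) = 0" by simp
  hence "matrix_inv T *v a = - x"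
    using inv by (simp add: matrix_vector_right_distrib eq_neg_iff_add_eq_0)
  thus False using small that by simp
qed

lemma norm_circle_map: "norm (circle_map T a x) = 1" if "norm x = 1"
  using nonzero[OF that] by (simp add: circle_map_def)

lemma continuous_circle_map: "continuous_on (sphere 0 1) (circle_map T a)"
  unfolding circle_map_def[abs_def]
  by (intro continuous_intros matrix_vector_mult_linear_continuous_on) (use nonzero in auto)

text \<open>The preimages of a unit vector \<open>u\<close> are the unit vectors of the form
  \<open>m *\<^sub>R w - b\<close> with \<open>m > 0\<close>, where
  \<open>w = matrix_inv T *v u\<close> and \<open>b = matrix_inv T *v a\<close>. The two ray lemmas
  give exactly one.\<close>

lemma bij_circle_map: "bij_betw (circle_map T a) (sphere 0 1) (sphere 0 1)"
  unfolding bij_betw_def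
proof
  define b where "b = matrix_inv T *v a"
  have form: "x = norm (a + T *v x) *\<^sub>R (matrix_inv T *v circle_map T a x) - b" if "norm x = 1" for x
    using nonzero[OF that] inv
    by (simp add: circle_map_def b_def matrix_vector_mult_scaleR matrix_vector_right_distrib)
  show "inj_on (circle_map T a) (sphere 0 1)"
  proof (rule inj_onI)
    fix x y assume *: "x \<in> sphere 0 1" "y \<in> sphere 0 1" "circle_map T a x = circle_map T a y"
    hence n: "norm x = 1" "norm y = 1" by auto
    have "norm (a + T *v x) = norm (a + T *v y)"
      by (rule ray_unique[of b _ _ "matrix_inv T *v circle_map T a x"])
        (use small form[OF n(1)] form[OF n(2)] n nonzero in \<open>auto simp: b_def[symmetric] *(3)\<close>)
    thus "x = y" using form[OF n(1)] form[OF n(2)] *(3) by metis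
  qed
  show "circle_map T a ` sphere 0 1 = sphere 0 1"
  proof
    show "circle_map T a ` sphere 0 1 \<subseteq> sphere 0 1" using norm_circle_map by auto
    show "sphere 0 1 \<subseteq> circle_map T a ` sphere 0 1"
    proof
      fix u :: "real^2" assume "u \<in> sphere 0 1"
      hence u: "norm u = 1" by simp
      have "T *v (matrix_inv T *v u) \<noteq> 0" using u inv by auto
      hence "matrix_inv T *v u \<noteq> 0" by auto
      then obtain m where m: "m > 0" "norm (m *\<^sub>R (matrix_inv T *v u) - b) = 1"
        using ray_exists small unfolding b_def by metis
      have "a + T *v (m *\<^sub>R (matrix_inv T *v u) - b) = m *\<^sub>R u"
        using inv by (simp add: b_def matrix_vector_mult_diff_distrib matrix_vector_mult_scaleR)
      hence "circle_map T a (m *\<^sub>R (matrix_inv T *v u) - b) = u"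
        using m u by (simp add: circle_map_def)
      thus "u \<in> circle_map T a ` sphere 0 1" using m by (metis imageI mem_sphere_0)
    qed
  qed
qed

text \<open>For unit \<open>p\<close> the area form satisfies
  \<open>\<bar>cross2 p y\<bar> \<le> norm (y - p)\<close>, so expansion measured by it passes to
  the distance. The limit \<open>L\<close> stands for the absolute multiplier at
  \<open>p\<close>.\<close>

lemma not_distal_circle_map:
  assumes p: "norm p = 1" "(circle_map T a ^^ N) p = p"
    and lim: "(\<phi> \<longlongrightarrow> L) (at p within sphere 0 1)" "L > 1"
    and bound: "\<And>z. norm z = 1 \<Longrightarrow> z \<noteq> p \<Longrightarrow>
      \<phi> z * norm (z - p) \<le> \<bar>cross2 p ((circle_map T a ^^ N) z)\<bar>"
  shows "\<not> distal (top_of_set (sphere 0 1)) (circle_map T a)"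
proof (rule not_distal_if_repelling_periodic_point[where k = "(1 + L) / 2" and N = N and p = p])
  \<comment> \<open>The midpoint of \<open>1\<close> and \<open>L\<close> lies strictly between
    them, so it exceeds 1 and is eventually below \<open>\<phi>\<close>.\<close>
  have "\<forall>\<^sub>F z in at p within sphere 0 1. (1 + L) / 2 < \<phi> z"
    using lim by (intro order_tendstoD) auto
  moreover have "\<forall>\<^sub>F z in at p within sphere 0 1. z \<in> sphere 0 1 \<and> z \<noteq> p"
    by (simp add: eventually_at_filter)
  ultimately show "\<forall>\<^sub>F z in at p within sphere 0 1.
      (1 + L) / 2 * dist z p \<le> dist ((circle_map T a ^^ N) z) p"
  proof eventually_elim
    case (elim z)
    have "(1 + L) / 2 * dist z p \<le> \<phi> z * norm (z - p)"
      using elim by (auto simp: dist_norm intro!: mult_right_mono)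
    also have "\<dots> \<le> \<bar>cross2 p ((circle_map T a ^^ N) z)\<bar>"
      using bound elim by auto
    also have "\<dots> = \<bar>cross2 p ((circle_map T a ^^ N) z - p)\<bar>"
      by (simp add: cross2_diff)
    also have "\<dots> \<le> dist ((circle_map T a ^^ N) z) p"
      using abs_cross2_le[of p "(circle_map T a ^^ N) z - p"] p by (simp add: dist_norm)
    finally show ?case .
  qed
qed (use assms in \<open>auto simp: islimpt_circle continuous_circle_map bij_circle_map\<close>)

end

section \<open>Translations that create repelling points of period one and two\<close>

lemma tendsto_circle_ratio:
  "((\<lambda>z. sqrt ((1 + p \<bullet> z) / 2)) \<longlongrightarrow> 1) (at p within S)" if "norm p = 1" for p :: "real^2"
proof -
  have "((\<lambda>z. sqrt ((1 + p \<bullet> z) / 2)) \<longlongrightarrow> sqrt ((1 + p \<bullet> p) / 2)) (at p within S)"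
    by (intro tendsto_intros) simp_all
  thus ?thesis using that by (simp add: norm_eq_1)
qed

text \<open>For \<open>a = r p - T p\<close> the map has derivative \<open>D / r\<close> along
  \<open>perp p\<close>, with \<open>D = cross2 p (T *v perp p)\<close>. Writing
  \<open>p = T w\<close> turns \<open>D\<close> into \<open>det T * (w \<bullet> p)\<close>, which
  is nonzero. So a small \<open>r\<close> makes \<open>p\<close> repelling, while
  \<open>w \<bullet> p > 0\<close> keeps \<open>r w - p\<close> inside the open unit ball.\<close>

lemma repelling_fixed_point:
  fixes T :: "real^2^2"
  assumes inv: "invertible T" and p: "norm p = 1" and c: "(matrix_inv T *v p) \<bullet> p > 0"
  shows "\<exists>a. 0 < norm (matrix_inv T *v a) \<and> norm (matrix_inv T *v a) < 1 \<and>
    has_fixed_point_on (sphere 0 1) (circle_map T a) \<and>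
    \<not> distal (top_of_set (sphere 0 1)) (circle_map T a)"
proof -
  define w where "w = matrix_inv T *v p"
  define D where "D = cross2 p (T *v perp p)"
  have Tw: "T *v w = p" using inv by (simp add: w_def)
  have "w \<noteq> 0" using c by (auto simp: w_def)
  have "D = cross2 (T *v w) (T *v perp p)" by (simp add: D_def Tw)
  hence "D = det T * (w \<bullet> p)" by (simp add: cross2_matrix cross2_perp)
  hence "D \<noteq> 0" using c inv by (simp add: w_def invertible_det_nz)
  have wp: "w \<bullet> p > 0" using c by (simp add: w_def)
  \<comment> \<open>The three bounds give in turn \<open>\<bar>D\<bar> / r > 1\<close>,
    \<open>r w \<noteq> p\<close> (so that \<open>a\<close> is nonzero) and
    \<open>norm (r w - p) < 1\<close>.\<close>
  define r where "r = min (\<bar>D\<bar> / 2) (min (1 / (2 * norm w)) (w \<bullet> p / (w \<bullet> w)))"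
  have r: "r > 0" "r < \<bar>D\<bar>" "r * norm w < 1" "r * (w \<bullet> w) \<le> w \<bullet> p"
  proof -
    show "r > 0" using wp \<open>w \<noteq> 0\<close> \<open>D \<noteq> 0\<close> by (simp add: r_def)
    have "r \<le> \<bar>D\<bar> / 2" "r \<le> 1 / (2 * norm w)" "r \<le> w \<bullet> p / (w \<bullet> w)"
      by (simp_all only: r_def min_le_iff_disj order_refl simp_thms)
    moreover have "w \<bullet> w > 0" "norm w > 0" using \<open>w \<noteq> 0\<close> by auto
    ultimately show "r < \<bar>D\<bar>" "r * norm w < 1" "r * (w \<bullet> w) \<le> w \<bullet> p"
      using \<open>D \<noteq> 0\<close> by (simp_all add: pos_le_divide_eq)
  qed
  define a where "a = r *\<^sub>R p - T *v p"
  have b: "matrix_inv T *v a = r *\<^sub>R w - p"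
    using inv by (simp add: a_def w_def matrix_vector_mult_diff_distrib matrix_vector_mult_scaleR)
  have "r *\<^sub>R w \<noteq> p"
    using r p by (metis abs_of_pos norm_scaleR order_less_irrefl)
  hence pos: "norm (matrix_inv T *v a) > 0" by (simp add: b)
  have small: "norm (matrix_inv T *v a) < 1"
  proof -
    have "(r *\<^sub>R w - p) \<bullet> (r *\<^sub>R w - p) = 1 + r * (r * (w \<bullet> w) - 2 * (w \<bullet> p))"
      using p by (simp add: norm_eq_1 inner_diff inner_commute algebra_simps)
    also have "\<dots> < 1" using r wp by (simp add: mult_pos_neg)
    finally show ?thesis by (simp add: b norm_eq_sqrt_inner)
  qed
  interpret circle_homeo T a by unfold_locales fact+
  have ap: "a + T *v p = r *\<^sub>R p" by (simp add: a_def)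
  have fp: "circle_map T a p = p" using r p by (simp add: circle_map_def ap)
  \<comment> \<open>The component of \<open>z\<close> along \<open>p\<close> falls short of 1 by
    \<open>1 - p \<bullet> z\<close>, which is half of \<open>(norm (z - p))\<^sup>2\<close>. Its
    effect on the area form is therefore \<open>B * (norm (z - p))\<^sup>2\<close>, a second-order
    error that vanishes in the limit of \<open>\<phi>\<close>.\<close>
  define B where "B = \<bar>cross2 p (T *v p)\<bar> / 2"
  define \<phi> where "\<phi> = (\<lambda>z. (\<bar>D\<bar> * sqrt ((1 + p \<bullet> z) / 2) - B * norm (z - p)) / norm (a + T *v z))"
  have "(\<phi> \<longlongrightarrow> (\<bar>D\<bar> * 1 - B * norm (p - p)) / norm (a + T *v p)) (at p within sphere 0 1)"
    unfolding \<phi>_def using nonzero[OF p]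
    by (intro tendsto_intros tendsto_circle_ratio p
        bounded_linear.tendsto[OF matrix_vector_mul_bounded_linear]) auto
  hence "(\<phi> \<longlongrightarrow> \<bar>D\<bar> / r) (at p within sphere 0 1)"
    using r p by (simp add: ap)
  moreover have "\<bar>D\<bar> / r > 1" using r by simp
  moreover have "\<phi> z * norm (z - p) \<le> \<bar>cross2 p ((circle_map T a ^^ 1) z)\<bar>" if z: "norm z = 1" for z
  proof -
    have 1: "1 - p \<bullet> z = (norm (z - p))\<^sup>2 / 2"
      using p z by (simp add: power2_norm_eq_inner inner_diff inner_commute norm_eq_1)
    have "a + T *v z = a + T *v ((p \<bullet> z) *\<^sub>R p + cross2 p z *\<^sub>R perp p)"
      using orthonormal_expansion[OF p, of z] by simp
    also have "\<dots> = r *\<^sub>R p - (1 - p \<bullet> z) *\<^sub>R (T *v p) + cross2 p z *\<^sub>R (T *v perp p)"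
      by (simp add: a_def matrix_vector_right_distrib matrix_vector_mult_scaleR algebra_simps)
    finally have "cross2 p (a + T *v z) = cross2 p z * D - (1 - p \<bullet> z) * cross2 p (T *v p)"
      by (simp add: cross2_add cross2_diff D_def)
    hence "\<bar>cross2 p (a + T *v z)\<bar> \<ge> \<bar>cross2 p z * D\<bar> - \<bar>(1 - p \<bullet> z) * cross2 p (T *v p)\<bar>"
      by linarith
    also have "\<bar>cross2 p z * D\<bar> = \<bar>D\<bar> * sqrt ((1 + p \<bullet> z) / 2) * norm (z - p)"
      using abs_cross2_unit[OF p z] by (simp only: abs_mult mult_ac)
    also have "\<bar>(1 - p \<bullet> z) * cross2 p (T *v p)\<bar> = B * norm (z - p) * norm (z - p)"
      by (simp add: abs_mult 1 B_def power2_eq_square)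
    finally have "(\<bar>D\<bar> * sqrt ((1 + p \<bullet> z) / 2) - B * norm (z - p)) * norm (z - p)
        \<le> \<bar>cross2 p (a + T *v z)\<bar>"
      by (simp only: left_diff_distrib)
    hence "\<phi> z * norm (z - p) \<le> \<bar>cross2 p (a + T *v z)\<bar> / norm (a + T *v z)"
      using divide_right_mono[OF _ norm_ge_zero] by (simp add: \<phi>_def)
    thus ?thesis by (simp add: circle_map_def abs_mult divide_inverse mult.commute)
  qed
  ultimately have "\<not> distal (top_of_set (sphere 0 1)) (circle_map T a)"
    using fp p by (intro not_distal_circle_map[where N = 1 and p = p]) auto
  moreover have "has_fixed_point_on (sphere 0 1) (circle_map T a)"
    using fp p by (auto simp: has_fixed_point_on_def)
  ultimately show ?thesis using pos small by blast
qed

text \<open>Since \<open>a\<close> and \<open>T v\<close> are multiples of \<open>v\<close>, the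
  form \<open>cross2 v\<close> kills \<open>a\<close> and is scaled by \<open>T\<close> by exactly
  \<open>\<mu>\<close>. Apart from this only the normalisation acts, so the two-step expansion is
  computed without an error term.\<close>

lemma repelling_2_periodic_point:
  fixes T :: "real^2^2"
  assumes inv: "invertible T" and v: "norm v = 1" and "l > 0" and Tv: "T *v v = - l *\<^sub>R v"
  shows "\<exists>a. 0 < norm (matrix_inv T *v a) \<and> norm (matrix_inv T *v a) < 1 \<and>
    has_periodic_point_of_order_2_on (sphere 0 1) (circle_map T a) \<and>
    \<not> distal (top_of_set (sphere 0 1)) (circle_map T a)"
proof -
  \<comment> \<open>The other eigenvalue, from \<open>- l * \<mu> = det T\<close>.\<close>
  define \<mu> where "\<mu> = - det T / l"
  have cross: "cross2 v (T *v z) = \<mu> * cross2 v z" for z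
    using cross2_matrix[of T v z] \<open>l > 0\<close>
    unfolding Tv cross2_scaleR \<mu>_def by (simp add: field_simps)
  have "\<mu> \<noteq> 0" using inv \<open>l > 0\<close> by (simp add: \<mu>_def invertible_det_nz)
  \<comment> \<open>\<open>q\<close> will be \<open>l\<^sup>2 - s\<^sup>2\<close>: being below
    \<open>l\<^sup>2\<close> it leaves \<open>s\<close> positive, and being below
    \<open>\<mu>\<^sup>2\<close> it makes the multiplier \<open>\<mu>\<^sup>2 / q\<close> exceed
    1.\<close>
  define q where "q = min (l\<^sup>2) (\<mu>\<^sup>2) / 2"
  have q: "0 < q" "q < l\<^sup>2" "q < \<mu>\<^sup>2"
    using \<open>l > 0\<close> \<open>\<mu> \<noteq> 0\<close> min.cobounded1[of "l\<^sup>2" "\<mu>\<^sup>2"] min.cobounded2[of "l\<^sup>2" "\<mu>\<^sup>2"]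
      zero_less_power2[of \<mu>] zero_less_power2[of l]
    unfolding q_def by (auto simp del: min.cobounded1 min.cobounded2 min_less_iff_disj intro: le_less_trans)
  define s where "s = sqrt (l\<^sup>2 - q)"
  have s: "0 < s" "s < l" "l\<^sup>2 - s\<^sup>2 = q"
    using q \<open>l > 0\<close> by (auto simp: s_def intro: real_less_lsqrt)
  define a where "a = s *\<^sub>R v"
  have "matrix_inv T *v (T *v v) = - l *\<^sub>R (matrix_inv T *v v)"
    by (simp only: Tv matrix_vector_mult_scaleR)
  hence "v = - l *\<^sub>R (matrix_inv T *v v)" using inv by simp
  hence "norm v = norm (- l *\<^sub>R (matrix_inv T *v v))" by simp
  hence "norm (matrix_inv T *v v) = 1 / l" using \<open>l > 0\<close> v by (simp add: field_simps)
  hence na: "norm (matrix_inv T *v a) = s / l" using s by (simp add: a_def matrix_vector_mult_scaleR)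
  have pos: "norm (matrix_inv T *v a) > 0" and small: "norm (matrix_inv T *v a) < 1"
    using s \<open>l > 0\<close> by (simp_all add: na)
  interpret circle_homeo T a by unfold_locales fact+
  let ?f = "circle_map T a"
  have av: "a + T *v v = - ((l - s) *\<^sub>R v)"
    by (simp add: a_def Tv algebra_simps)
  have "T *v (- v) = l *\<^sub>R v"
    using Tv matrix_vector_mult_scaleR[of T "-1" v] by simp
  hence av': "a + T *v (- v) = (l + s) *\<^sub>R v"
    by (simp add: a_def algebra_simps)
  have f1: "?f v = - v" using s v unfolding circle_map_def av by simp
  have f2: "?f (- v) = v" using s v unfolding circle_map_def av' by simp
  define \<phi> where "\<phi> = (\<lambda>z. \<mu>\<^sup>2 * sqrt ((1 + v \<bullet> z) / 2) / (norm (a + T *v z) * norm (a + T *v ?f z)))"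
  have f_lim: "(?f \<longlongrightarrow> ?f v) (at v within sphere 0 1)"
    using continuous_circle_map v by (auto simp: continuous_on_def)
  have "(\<phi> \<longlongrightarrow> \<mu>\<^sup>2 * 1 / (norm (a + T *v v) * norm (a + T *v ?f v))) (at v within sphere 0 1)"
    unfolding \<phi>_def using nonzero[OF v] nonzero[OF norm_circle_map[OF v]]
    by (intro tendsto_intros tendsto_circle_ratio v f_lim
        bounded_linear.tendsto[OF matrix_vector_mul_bounded_linear]) auto
  \<comment> \<open>The normalising factors are \<open>l - s\<close> at \<open>v\<close> and
    \<open>l + s\<close> at \<open>- v\<close>.\<close>
  moreover have "norm (a + T *v v) * norm (a + T *v ?f v) = q"
    unfolding f1 av av' norm_minus_cancel norm_scaleR s(3)[symmetric]
    using s v by (simp add: abs_of_pos power2_eq_square square_diff_square_factored mult.commute)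
  ultimately have "(\<phi> \<longlongrightarrow> \<mu>\<^sup>2 / q) (at v within sphere 0 1)" by simp
  moreover have "\<mu>\<^sup>2 / q > 1" using q by simp
  moreover have "\<phi> z * norm (z - v) \<le> \<bar>cross2 v ((?f ^^ 2) z)\<bar>" if z: "norm z = 1" for z
  proof -
    have f: "cross2 v (?f x) = \<mu> * cross2 v x / norm (a + T *v x)" for x
      unfolding circle_map_def by (simp add: cross2_add cross a_def field_simps)
    have "cross2 v ((?f ^^ 2) z) = \<mu>\<^sup>2 * cross2 v z / (norm (a + T *v z) * norm (a + T *v ?f z))"
      by (simp add: numeral_2_eq_2 f power2_eq_square)
    hence "\<bar>cross2 v ((?f ^^ 2) z)\<bar> = \<phi> z * norm (z - v)"
      by (simp add: abs_mult \<phi>_def abs_cross2_unit[OF v z] field_simps)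
    thus ?thesis by simp
  qed
  ultimately have "\<not> distal (top_of_set (sphere 0 1)) ?f"
    using f1 f2 v by (intro not_distal_circle_map[where N = 2 and p = v]) (auto simp: numeral_2_eq_2)
  moreover have "- v \<noteq> v"
    using av av' s v f1 f2 by (metis add_eq_0_iff2 norm_zero scaleR_2 scaleR_eq_0_iff zero_neq_numeral zero_neq_one)
  hence "has_periodic_point_of_order_2_on (sphere 0 1) ?f"
    using f1 f2 v by (auto simp: has_periodic_point_of_order_2_on_def intro!: bexI[of _ v])
  ultimately show ?thesis using pos small by blast
qed

section \<open>Characteristic polynomials of two by two matrices\<close>

text \<open>Eigenvectors are the nonzero kernel vectors of \<open>A - mat l\<close>, so they exist
  iff this matrix is singular. A general field serves both \<open>T\<close> and its
  complexification.\<close>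

lemma eigenvalues_2:
  fixes A :: "'a::field^2^2"
  shows "l \<in> eigenvalues A \<longleftrightarrow> l\<^sup>2 - (A$1$1 + A$2$2) * l + det A = 0"
proof -
  have "A *v v = l *s v \<longleftrightarrow> (A - mat l) *v v = 0" for v
  proof -
    have "mat l *v v = l *s v"
      by (simp add: vec_eq_iff matrix_vector_mult_def mat_def sum_2 forall_2)
    thus ?thesis by (simp add: matrix_vector_mult_diff_rdistrib)
  qed
  hence "l \<in> eigenvalues A \<longleftrightarrow> \<not> invertible (A - mat l)"
    unfolding eigenvalues_def invertible_left_inverse matrix_left_invertible_ker by blast
  also have "\<dots> \<longleftrightarrow> det (A - mat l) = 0" by (simp add: invertible_det_nz)
  also have "det (A - mat l) = l\<^sup>2 - (A$1$1 + A$2$2) * l + det A"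
    by (simp add: det_2 mat_def algebra_simps power2_eq_square)
  finally show ?thesis .
qed

lemma complex_eigenvalues_2:
  fixes T :: "real^2^2"
  shows "l \<in> complex_eigenvalues T \<longleftrightarrow>
    l\<^sup>2 - of_real (T$1$1 + T$2$2) * l + of_real (det T) = 0"
  unfolding complex_eigenvalues_def eigenvalues_2
  by (simp add: det_2 map_matrix_def)

text \<open>The inclusion alone does not produce an eigenvalue; the quadratic formula does, with the
  root \<open>z\<close>. It is real by the hypothesis, and the characteristic polynomial has the
  same coefficients over both fields.\<close>

lemma real_unit_eigenvector:
  fixes T :: "real^2^2"
  assumes "complex_eigenvalues T \<subseteq> \<real>"
  obtains l v where "norm v = 1" "T *v v = l *\<^sub>R v"
proof -
  define tr where "tr = complex_of_real (T$1$1 + T$2$2)"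
  define z where "z = (tr + csqrt (tr\<^sup>2 - 4 * of_real (det T))) / 2"
  have "(2 * z - tr)\<^sup>2 = tr\<^sup>2 - 4 * of_real (det T)"
    by (simp add: z_def field_simps)
  hence "4 * (z\<^sup>2 - tr * z + of_real (det T)) = 0"
    by (simp add: power2_eq_square algebra_simps)
  hence "z \<in> complex_eigenvalues T"
    unfolding complex_eigenvalues_2 tr_def by (metis mult_eq_0_iff zero_neq_numeral)
  moreover from this obtain l where l: "z = of_real l" using assms by (auto elim: Reals_cases)
  ultimately have "of_real (l\<^sup>2 - (T$1$1 + T$2$2) * l + det T) = (0::complex)"
    unfolding complex_eigenvalues_2 by simp
  hence "l\<^sup>2 - (T$1$1 + T$2$2) * l + det T = 0"
    by (simp only: of_real_eq_0_iff)
  hence "l \<in> eigenvalues T" by (simp add: eigenvalues_2)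
  then obtain v where "v \<noteq> 0" "T *v v = l *\<^sub>R v"
    unfolding eigenvalues_def by (auto simp: scalar_mult_eq_scaleR)
  thus ?thesis
    by (intro that[of "v /\<^sub>R norm v" l]) (simp_all add: matrix_vector_mult_scaleR)
qed

text \<open>The imaginary part of the characteristic equation, divided by
  \<open>t * sin \<theta>\<close>, gives the trace; the real part then gives the
  determinant.\<close>

lemma trace_det_of_complex_pair:
  fixes T :: "real^2^2"
  assumes "t > 0" "sin \<theta> \<noteq> 0"
    and "of_real t * (of_real (cos \<theta>) + \<i> * of_real (sin \<theta>)) \<in> complex_eigenvalues T"
  shows "T$1$1 + T$2$2 = 2 * t * cos \<theta>" "det T = t\<^sup>2"
proof -
  define tr where "tr = T$1$1 + T$2$2"
  have eq: "(of_real t * (of_real (cos \<theta>) + \<i> * of_real (sin \<theta>)))\<^sup>2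
      - of_real tr * (of_real t * (of_real (cos \<theta>) + \<i> * of_real (sin \<theta>))) + complex_of_real (det T) = 0"
    using assms(3) unfolding complex_eigenvalues_2 tr_def .
  have "t * sin \<theta> * (2 * t * cos \<theta> - tr) = 0"
    using arg_cong[OF eq, of Im] by (simp add: power2_eq_square algebra_simps)
  hence tr: "tr = 2 * t * cos \<theta>" using assms by simp
  thus "T$1$1 + T$2$2 = 2 * t * cos \<theta>" by (simp add: tr_def)
  have "t\<^sup>2 * ((cos \<theta>)\<^sup>2 - (sin \<theta>)\<^sup>2) - tr * (t * cos \<theta>) + det T = 0"
    using arg_cong[OF eq, of Re] by (simp add: power2_eq_square algebra_simps)
  hence "det T = (t * sin \<theta>)\<^sup>2 + (t * cos \<theta>)\<^sup>2"
    by (simp add: tr power2_eq_square algebra_simps)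
  also have "\<dots> = t\<^sup>2 * ((sin \<theta>)\<^sup>2 + (cos \<theta>)\<^sup>2)"
    by (simp only: power_mult_distrib distrib_left)
  finally show "det T = t\<^sup>2" by simp
qed

section \<open>The quadratic form of the matrix and its Frobenius norm\<close>

text \<open>Negative semidefiniteness gives the discriminant inequality
  \<open>(B + C)\<^sup>2 \<le> 4 * A * D\<close>. Adding
  \<open>(A + D)\<^sup>2 \<le> 4 * (A * D - B * C)\<close> and collecting the mixed terms yields the
  bound.\<close>

lemma frobenius_bound:
  fixes T :: "real^2^2"
  assumes nonpos: "\<And>q. q \<bullet> (T *v q) \<le> 0" and tr: "(T$1$1 + T$2$2)\<^sup>2 \<le> 4 * det T"
  shows "(T$1$1)\<^sup>2 + (T$1$2)\<^sup>2 + (T$2$1)\<^sup>2 + (T$2$2)\<^sup>2 \<le> 6 * det T"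
proof -
  define A B C D where "A = T$1$1" and "B = T$1$2" and "C = T$2$1" and "D = T$2$2"
  note defs = A_def B_def C_def D_def
  have form: "A * x\<^sup>2 + (B + C) * x * y + D * y\<^sup>2 \<le> 0" for x y
    using nonpos[of "vector [x, y]"]
    by (simp add: vec2_simps defs power2_eq_square algebra_simps)
  have "(B + C)\<^sup>2 \<le> 4 * A * D"
  proof (rule ccontr)
    assume neg: "\<not> (B + C)\<^sup>2 \<le> 4 * A * D"
    have "A \<le> 0" "D \<le> 0" using form[of 1 0] form[of 0 1] by auto
    show False
    proof (cases "A = 0")
      case True
      hence "B + C \<noteq> 0" using neg by auto
      \<comment> \<open>The first coordinate is chosen so that the form takes the value
        \<open>(1 - D) + D = 1\<close>.\<close>
      moreover have "(B + C) * ((1 - D) / (B + C)) * 1 + D * 1\<^sup>2 \<le> 0"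
        using form[of "(1 - D) / (B + C)" 1] True by simp
      ultimately show False by simp
    next
      case False
      \<comment> \<open>The point \<open>x = B + C\<close>, \<open>y = - 2 * A\<close> is where the
        form is stationary in \<open>x\<close> for fixed \<open>y\<close>, so its value is
        \<open>A\<close> times the negated discriminant.\<close>
      have "A * (B + C)\<^sup>2 + (B + C) * (B + C) * (- 2 * A) + D * (- 2 * A)\<^sup>2 \<le> 0"
        by (rule form)
      hence "A * (4 * A * D - (B + C)\<^sup>2) \<le> 0"
        by (simp add: power2_eq_square algebra_simps)
      moreover have "A * (4 * A * D - (B + C)\<^sup>2) > 0"
        using False \<open>A \<le> 0\<close> neg by (intro mult_neg_neg) auto
      ultimately show False by simp
    qed
  qed
  moreover have "(A + D)\<^sup>2 \<le> 4 * (A * D - B * C)"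
    using tr by (simp add: defs det_2)
  ultimately have "A\<^sup>2 + B\<^sup>2 + C\<^sup>2 + D\<^sup>2 \<le> 6 * (A * D - B * C)"
    by (simp add: power2_eq_square algebra_simps)
  thus ?thesis by (simp add: defs det_2)
qed

lemma onorm_le_frobenius:
  fixes T :: "real^2^2"
  shows "onorm ((*v) T) \<le> sqrt ((T$1$1)\<^sup>2 + (T$1$2)\<^sup>2 + (T$2$1)\<^sup>2 + (T$2$2)\<^sup>2)"
proof (rule onorm_le)
  fix x :: "real^2"
  \<comment> \<open>Lagrange's identity, summed over the rows of \<open>T\<close>.\<close>
  have "(T$1$1 * x$1 + T$1$2 * x$2)\<^sup>2 + (T$2$1 * x$1 + T$2$2 * x$2)\<^sup>2
      + ((T$1$1 * x$2 - T$1$2 * x$1)\<^sup>2 + (T$2$1 * x$2 - T$2$2 * x$1)\<^sup>2)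
    = ((T$1$1)\<^sup>2 + (T$1$2)\<^sup>2 + (T$2$1)\<^sup>2 + (T$2$2)\<^sup>2) * ((x$1)\<^sup>2 + (x$2)\<^sup>2)"
    by (simp add: power2_eq_square algebra_simps)
  hence "(T$1$1 * x$1 + T$1$2 * x$2)\<^sup>2 + (T$2$1 * x$1 + T$2$2 * x$2)\<^sup>2
    \<le> ((T$1$1)\<^sup>2 + (T$1$2)\<^sup>2 + (T$2$1)\<^sup>2 + (T$2$2)\<^sup>2) * ((x$1)\<^sup>2 + (x$2)\<^sup>2)"
    by (smt (verit) zero_le_power2)
  thus "norm (T *v x) \<le> sqrt ((T$1$1)\<^sup>2 + (T$1$2)\<^sup>2 + (T$2$1)\<^sup>2 + (T$2$2)\<^sup>2) * norm x"
    by (simp add: vec2_simps flip: real_sqrt_mult power2_eq_square)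
qed

text \<open>For \<open>p\<close> with \<open>perp p\<close> along \<open>q\<close>, the number
  \<open>det T * ((matrix_inv T *v p) \<bullet> p)\<close> is the area spanned by \<open>p\<close>
  and \<open>T *v perp p\<close>, which is the quadratic form of \<open>T\<close> at
  \<open>perp p\<close>.\<close>

lemma repelling_fixed_point_if_form_pos:
  fixes T :: "real^2^2"
  assumes inv: "invertible T" and "det T > 0" and "q \<bullet> (T *v q) > 0"
  shows "\<exists>a. 0 < norm (matrix_inv T *v a) \<and> norm (matrix_inv T *v a) < 1 \<and>
    has_fixed_point_on (sphere 0 1) (circle_map T a) \<and>
    \<not> distal (top_of_set (sphere 0 1)) (circle_map T a)"
proof -
  have "q \<noteq> 0" using assms(3) by auto
  \<comment> \<open>\<open>perp\<close> is a quarter turn and squares to minus the identity, hence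
    the sign.\<close>
  define p where "p = - perp (q /\<^sub>R norm q)"
  have np: "norm p = 1" using \<open>q \<noteq> 0\<close> by (simp add: p_def)
  have pp: "perp p = q /\<^sub>R norm q"
    by (simp add: p_def perp_def vec_eq_iff forall_2)
  have cr: "cross2 p y = perp p \<bullet> y" for y
    by (simp add: cross2_def perp_def vec2_simps)
  have "det T * ((matrix_inv T *v p) \<bullet> p) = cross2 (T *v (matrix_inv T *v p)) (T *v perp p)"
    by (simp only: cross2_matrix cross2_perp)
  also have "\<dots> = perp p \<bullet> (T *v perp p)" using inv by (simp add: cr)
  also have "\<dots> > 0"
    using assms(3) \<open>q \<noteq> 0\<close> by (simp add: pp matrix_vector_mult_scaleR)
  finally have "(matrix_inv T *v p) \<bullet> p > 0"
    using \<open>det T > 0\<close> by (simp add: zero_less_mult_iff)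
  thus ?thesis using repelling_fixed_point[OF inv np] by blast
qed

section \<open>Real and non-real spectrum combined\<close>

theorem corollary10:
  fixes T :: "real^2^2"
  assumes "invertible T"
    and "complex_eigenvalues T \<subseteq> \<real> \<or>
      (\<exists>t \<theta> :: real. t > 0 \<and> sin \<theta> \<noteq> 0 \<and>
        complex_eigenvalues T =
          {of_real t * (of_real (cos \<theta>) + \<i> * of_real (sin \<theta>)),
           of_real t * (of_real (cos \<theta>) - \<i> * of_real (sin \<theta>))} \<and>
        ((0 < cos \<theta> \<and> cos \<theta> < 1) \<or> onorm ((*v) T) > 5 * sqrt (det T)))"
  shows "\<exists>a :: real^2.
    0 < norm (matrix_inv T *v a) \<and> norm (matrix_inv T *v a) < 1 \<and>
    (has_fixed_point_on (sphere 0 1) (circle_map T a) \<or>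
     has_periodic_point_of_order_2_on (sphere 0 1) (circle_map T a)) \<and>
    \<not> distal (top_of_set (sphere 0 1)) (circle_map T a)"
  using assms(2)
proof
  assume "complex_eigenvalues T \<subseteq> \<real>"
  then obtain l v where v: "norm v = 1" "T *v v = l *\<^sub>R v" by (rule real_unit_eigenvector)
  have lv: "v = l *\<^sub>R (matrix_inv T *v v)"
    using arg_cong[OF v(2), of "(*v) (matrix_inv T)"] assms(1) by (simp add: matrix_vector_mult_scaleR)
  hence "l \<noteq> 0" using v by auto
  show ?thesis
  proof (cases "l > 0")
    case True
    have "v \<bullet> v = l * ((matrix_inv T *v v) \<bullet> v)"
      using arg_cong[OF lv, of "\<lambda>x. x \<bullet> v"] by simp
    hence "(matrix_inv T *v v) \<bullet> v > 0"
      using v True by (metis norm_eq_1 zero_less_mult_pos zero_less_one)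
    thus ?thesis using repelling_fixed_point[OF assms(1) v(1)] by blast
  next
    case False
    thus ?thesis using repelling_2_periodic_point[OF assms(1) v(1), of "- l"] v \<open>l \<noteq> 0\<close> by auto
  qed
next
  assume "\<exists>t \<theta> :: real. t > 0 \<and> sin \<theta> \<noteq> 0 \<and>
        complex_eigenvalues T =
          {of_real t * (of_real (cos \<theta>) + \<i> * of_real (sin \<theta>)),
           of_real t * (of_real (cos \<theta>) - \<i> * of_real (sin \<theta>))} \<and>
        ((0 < cos \<theta> \<and> cos \<theta> < 1) \<or> onorm ((*v) T) > 5 * sqrt (det T))"
  then obtain t \<theta> where t: "t > 0" "sin \<theta> \<noteq> 0"
    and mem: "of_real t * (of_real (cos \<theta>) + \<i> * of_real (sin \<theta>)) \<in> complex_eigenvalues T"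
    and alt: "cos \<theta> > 0 \<or> onorm ((*v) T) > 5 * sqrt (det T)"
    by blast
  note td = trace_det_of_complex_pair[OF t mem]
  have "det T > 0" using td t by simp
  have "\<exists>q. q \<bullet> (T *v q) > 0"
  proof (rule ccontr)
    assume "\<nexists>q. q \<bullet> (T *v q) > 0"
    hence np: "q \<bullet> (T *v q) \<le> 0" for q by (meson not_le)
    have "T$1$1 \<le> 0" "T$2$2 \<le> 0"
      using np[of "vector [1, 0]"] np[of "vector [0, 1]"] by (simp_all add: vec2_simps)
    \<comment> \<open>The trace \<open>2 * t * cos \<theta>\<close> is nonpositive, which leaves
      only the alternative on the operator norm.\<close>
    hence "\<not> cos \<theta> > 0"
      using td(1) t(1) mult_pos_pos[of t "cos \<theta>"] by linarith
    hence on: "onorm ((*v) T) > 5 * sqrt (det T)" using alt by simp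
    have "(T$1$1 + T$2$2)\<^sup>2 \<le> 4 * det T"
      unfolding td using t by (simp add: power_mult_distrib abs_square_le_1)
    hence "onorm ((*v) T) \<le> sqrt (6 * det T)"
      using order_trans[OF onorm_le_frobenius real_sqrt_le_mono[OF frobenius_bound[OF np]]] by blast
    also have "\<dots> \<le> sqrt (25 * det T)" using \<open>det T > 0\<close> by simp
    also have "\<dots> = 5 * sqrt (det T)" by (simp add: real_sqrt_mult)
    finally show False using on by simp
  qed
  thus ?thesis using repelling_fixed_point_if_form_pos[OF assms(1) \<open>det T > 0\<close>] by blast
qed

end
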